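(* (a) For integers $s\ge0$ and $n\ge1$, the Ramanujan polynomial satisfies $$[1-(-1)^n]R_{2s+1}^{(n)}(1)+\sum_{j=1}^{n-1}\binom nj\left[\frac{(n-1)!}{(j-1)!}-(-1)^j(2s+2)_{n-j}\right]R_{2s+1}^{(j)}(1)=(2s+2)_nR_{2s+1}(1).$$ (b) For integers $s\ge1$ and $n\ge1$, with $R_{2s}=Q_{2s}$ and $T(z)=R_{2s}(z)-R_{2s}(z/2)$ (so $T^{(j)}(1)=R_{2s}^{(j)}(1)-2^{-j}R_{2s}^{(j)}(1/2)$), $$[1-(-1)^n]T^{(n)}(1)+\sum_{j=1}^{n-1}\binom nj\left[\frac{(n-1)!}{(j-1)!}-(-1)^j(2s+2)_{n-j}\right]T^{(j)}(1)=(2s+2)_n\,T(1).$$ (c) Let $r$ be real, $\delta$ an integer, $F$ analytic on the upper half plane $\mathbb H$ and $S$ analytic on the right half plane, and suppose that for all $z\in\mathbb H$ $$F\!\left(-\frac1z\right)-(-1)^\delta\left(\frac zi\right)^rF(z)=S\!\left(\frac zi\right)$$ (principal branch of the power). Then for every integer $n\ge1$, $$[(-1)^n-(-1)^\delta]F^{(n)}(i)-(-1)^\delta(-r)_n\,i^nF(i)+\sum_{j=1}^{n-1}\binom nj\left[(-1)^n\frac{(n-1)!}{(j-1)!}-(-1)^\delta(-1)^{n-j}(-r)_{n-j}\right]i^{j-n}F^{(j)}(i)=\frac{1}{i^n}S^{(n)}(1).$$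
   Context: $B_n$ are the Bernoulli numbers ($x/(e^x-1)=\sum B_nx^n/n!$). Define $B_0^*=1$, $B_1^*=1/4$ and for $s\ge2$, $B_s^*=-\frac{1}{s+1}\sum_{k=0}^{s-1}\binom{s+1}{k}2^{k-s}B_k$. The Ramanujan polynomials are $R_{2s+1}(z)=\sum_{k=0}^{s+1}\frac{B_{2k}B_{2s+2-2k}}{(2k)!(2s+2-2k)!}z^{2k}$, and the generalized Ramanujan polynomials are $Q_r(z)=\sum_{k=0}^{\lfloor (r+1)/2\rfloor}\frac{B^*_{r+1-2k}B^*_{2k}}{(r+1-2k)!(2k)!}z^{2k}$. $(a)_j=\Gamma(a+j)/\Gamma(a)$ is the Pochhammer symbol, and $f^{(j)}$ denotes the $j$-th derivative. *)

theory Defs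
  imports "HOL-Analysis.Analysis" "HOL-Computational_Algebra.Computational_Algebra"
begin

definition bernoulli :: "nat \<Rightarrow> real" where
  "bernoulli n = fact n * fps_nth (fps_X / (fps_exp 1 - 1)) n"

definition bernoulli_star :: "nat \<Rightarrow> real" where
  "bernoulli_star s =
     (if s = 0 then 1 else if s = 1 then 1/4
      else - (1 / real (s + 1)) *
           (\<Sum>k = 0..s - 1. real ((s + 1) choose k) * 2 powi (int k - int s) * bernoulli k))"

definition ramanujan_poly :: "nat \<Rightarrow> real poly" where
  "ramanujan_poly s =
     (\<Sum>k = 0..s + 1. monom (bernoulli (2 * k) * bernoulli (2 * s + 2 - 2 * k)
                              / (fact (2 * k) * fact (2 * s + 2 - 2 * k))) (2 * k))"

definition gen_ramanujan_poly :: "nat \<Rightarrow> real poly" where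
  "gen_ramanujan_poly r =
     (\<Sum>k = 0..(r + 1) div 2. monom (bernoulli_star (r + 1 - 2 * k) * bernoulli_star (2 * k)
                              / (fact (r + 1 - 2 * k) * fact (2 * k))) (2 * k))"

end

theory Submission
  imports Defs "HOL-Complex_Analysis.Complex_Analysis"
begin

text \<open>
  The Ramanujan polynomial and the polynomial \<open>T\<close> are palindromic of formal degree \<open>2s + 2\<close>, i.e. they
  satisfy \<open>p(1/u) - u powr (-(2s + 2)) p(u) = 0\<close>; with \<open>G(u) = F(iu)\<close> the hypothesis of (c) likewise reads
  \<open>G(1/u) - (-1) powi \<delta> u powr r G(u) = S(u)\<close>. All three identities result from differentiating such a
  relation \<open>n\<close> times at the fixed point \<open>u = 1\<close>: the derivatives of \<open>G(1/u)\<close> bring in the Lah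
  numbers, and the Leibniz rule for \<open>u powr r G(u)\<close> brings in the Pochhammer symbols.

  For \<open>T\<close> the symmetry of the coefficients comes from \<open>e\<^sup>x b(2x) = 2 b(x) - b(2x)\<close>, where
  \<open>b(x) = x / (e\<^sup>x - 1)\<close>: it evaluates the sum defining \<open>B\<^sup>*\<^sub>s\<close> and gives \<open>B\<^sup>*\<^sub>2\<^sub>k = B\<^sub>2\<^sub>k\<close> and
  \<open>B\<^sup>*\<^sub>2\<^sub>k\<^sub>-\<^sub>1 / (2k - 1)! = 4 (1 - 4\<^sup>-\<^sup>k) B\<^sub>2\<^sub>k / (2k)!\<close> for \<open>k \<ge> 1\<close>.
\<close>

section \<open>Higher derivatives of \<open>f (inverse w)\<close> and of powers\<close>

text \<open>A guessed closed form for all derivatives only has to be checked under one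
  differentiation. On an open set two functions that agree there also agree near each point, so
  \<open>deriv\<close> may be applied to the closed form instead.\<close>

lemma higher_deriv_eqI:
  fixes g :: "nat \<Rightarrow> 'a::real_normed_field \<Rightarrow> 'a"
  assumes "open S"
    and g: "\<And>n z. z \<in> S \<Longrightarrow> (g n has_field_derivative g (Suc n) z) (at z)"
    and "z \<in> S"
  shows "(deriv ^^ n) (g 0) z = g n z"
  using \<open>z \<in> S\<close>
proof (induction n arbitrary: z)
  case (Suc n)
  have "deriv ((deriv ^^ n) (g 0)) z = deriv (g n) z"
    using Suc \<open>open S\<close> by (intro deriv_cong_ev eventually_nhds_in_open[THEN eventually_mono]) auto
  also have "\<dots> = g (Suc n) z"
    using g[OF Suc.prems] by (rule DERIV_imp_deriv)
  finally show ?case by simp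
qed simp

text \<open>This is the Lah number \<open>L(m + 1, i + 1)\<close>, the shift avoiding the junk value of \<open>1 / (-1)!\<close>.\<close>
definition lah :: "nat \<Rightarrow> nat \<Rightarrow> 'a::field_char_0" where
  "lah m i = of_nat (Suc m choose Suc i) * (fact m / fact i)"

lemma lah_Suc_0: "lah (Suc m) 0 = of_nat (m + 2) * lah m 0"
  by (simp add: lah_def algebra_simps)

lemma lah_eq_0: "i > m \<Longrightarrow> lah m i = 0"
  by (simp add: lah_def del: binomial_Suc_Suc)

text \<open>The recurrence L(n+1,k) = L(n,k-1) + (n+k) L(n,k) at n = m+1, k = i+2. After a common
  factor is removed, it reduces to the absorption identity (i+2) C(m+1,i+2) = (m-i)
  C(m+1,i+1).\<close>

lemma lah_Suc_Suc:
  "lah (Suc m) (Suc i) = lah m i + of_nat (m + i + 3) * (lah m (Suc i) :: 'a::field_char_0)"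
proof (cases "i \<le> m")
  case True
  let ?b = "of_nat (Suc m choose Suc i) :: 'a" and ?c = "of_nat (Suc m choose Suc (Suc i)) :: 'a"
  have "Suc (Suc i) * (Suc m choose Suc (Suc i)) = (m - i) * (Suc m choose Suc i)"
    using binomial_absorption[of "Suc i" "Suc m"] binomial_absorb_comp[of "Suc m" "Suc i"] by simp
  then have "of_nat (Suc (Suc i) * (Suc m choose Suc (Suc i))) = (of_nat ((m - i) * (Suc m choose Suc i)) :: 'a)"
    by (rule arg_cong)
  then have *: "(2 + of_nat i) * ?c = (of_nat m - of_nat i) * ?b"
    using True by (simp add: of_nat_diff algebra_simps del: binomial_Suc_Suc)
  have b: "of_nat (Suc (Suc m) choose Suc (Suc i)) = ?b + ?c"
    by simp
  have "lah (Suc m) (Suc i) - lah m i - of_nat (m + i + 3) * (lah m (Suc i) :: 'a)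
     = fact m / fact (Suc i) *
        ((of_nat m + 1) * (?b + ?c) - (of_nat i + 1) * ?b - of_nat (m + i + 3) * ?c)"
    unfolding lah_def b fact_Suc[of m] fact_Suc[of i]
    by (simp add: field_simps del: binomial_Suc_Suc of_nat_Suc)
      (simp add: algebra_simps del: binomial_Suc_Suc)
  also have "(of_nat m + 1) * (?b + ?c) - (of_nat i + 1) * ?b - of_nat (m + i + 3) * ?c = 0"
    using * by (simp add: algebra_simps del: binomial_Suc_Suc)
  finally show ?thesis by (simp add: algebra_simps)
next
  case False
  then show ?thesis by (simp add: lah_eq_0)
qed

text \<open>Differentiating a summand raises either the order of the derivative of \<open>f\<close>
  or only the power of \<open>inverse w\<close>; the two contributions combine by the Lah
  recurrences.\<close>

lemma higher_deriv_compose_inverse: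
  fixes f :: "complex \<Rightarrow> complex"
  assumes f: "f holomorphic_on T" and "open S" "open T" "0 \<notin> S"
    and inv: "\<And>w. w \<in> S \<Longrightarrow> inverse w \<in> T" and "z \<in> S"
  shows "(deriv ^^ Suc m) (\<lambda>w. f (inverse w)) z =
    (-1) ^ Suc m * (\<Sum>i\<le>m. lah m i * (deriv ^^ Suc i) f (inverse z) * inverse z ^ (m + i + 2))"
proof -
  define g where "g = (\<lambda>n w. case n of 0 \<Rightarrow> f (inverse w) | Suc m \<Rightarrow>
    (-1) ^ Suc m * (\<Sum>i\<le>m. lah m i * (deriv ^^ Suc i) f (inverse w) * inverse w ^ (m + i + 2)))"
  have D: "((\<lambda>w. (deriv ^^ i) f (inverse w)) has_field_derivative
      - (deriv ^^ Suc i) f (inverse w) * inverse w ^ 2) (at w)" if "w \<in> S" for i w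
  proof -
    have "((deriv ^^ i) f has_field_derivative (deriv ^^ Suc i) f (inverse w)) (at (inverse w))"
      using has_field_derivative_higher_deriv[OF f \<open>open T\<close> inv[OF that]] .
    moreover have "(inverse has_field_derivative - (inverse w ^ 2)) (at w)"
      using that \<open>0 \<notin> S\<close> by (auto intro!: derivative_eq_intros simp: power2_eq_square)
    ultimately show ?thesis
      using DERIV_chain2 by fastforce
  qed
  have "(g n has_field_derivative g (Suc n) w) (at w)" if w: "w \<in> S" for n w
  proof (cases n)
    case 0
    then show ?thesis
      using D[OF w, of 0] by (simp add: g_def lah_def numeral_2_eq_2)
  next
    case (Suc m)
    have "w \<noteq> 0" using w \<open>0 \<notin> S\<close> by auto
    let ?v = "inverse w" and ?D = "\<lambda>i. (deriv ^^ Suc i) f (inverse w)"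
    have "((\<lambda>w. inverse w ^ Suc k) has_field_derivative - of_nat (Suc k) * ?v ^ (k + 2)) (at w)" for k
      using \<open>w \<noteq> 0\<close>
      by (auto intro!: derivative_eq_intros simp: algebra_simps simp del: power_Suc) (simp add: algebra_simps)
    from this[of "m + i + 1" for i]
    have P: "((\<lambda>w. inverse w ^ (m + i + 2)) has_field_derivative
        - of_nat (m + i + 2) * ?v ^ (m + i + 3)) (at w)" for i
      by (simp add: eval_nat_numeral)
    have "(g (Suc m) has_field_derivative (-1) ^ Suc m * (\<Sum>i\<le>m. lah m i *
        (- ?D (Suc i) * ?v ^ 2 * ?v ^ (m + i + 2) + - of_nat (m + i + 2) * ?v ^ (m + i + 3) * ?D i))) (at w)"
      unfolding g_def nat.case mult.assoc
      by (intro DERIV_cmult DERIV_sum DERIV_mult[OF D[OF w] P, unfolded mult.assoc])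
    also have "(\<Sum>i\<le>m. lah m i *
        (- ?D (Suc i) * ?v ^ 2 * ?v ^ (m + i + 2) + - of_nat (m + i + 2) * ?v ^ (m + i + 3) * ?D i))
      = - ((\<Sum>i\<le>m. lah m i * ?D (Suc i) * ?v ^ (m + i + 4))
         + (\<Sum>i\<le>m. of_nat (m + i + 2) * lah m i * ?D i * ?v ^ (m + i + 3)))"
      unfolding sum.distrib[symmetric] sum_negf[symmetric]
      by (intro sum.cong refl) (simp add: algebra_simps power_add eval_nat_numeral del: of_nat_Suc funpow.simps)
    \<comment> \<open>The added term at \<open>Suc m\<close> vanishes because
      \<open>lah m (Suc m) = 0\<close>. The longer sum can then be split at 0 and shifted to line up
      with the other one.\<close>
    also have "(\<Sum>i\<le>m. of_nat (m + i + 2) * lah m i * ?D i * ?v ^ (m + i + 3))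
       = (\<Sum>i\<le>Suc m. of_nat (m + i + 2) * lah m i * ?D i * ?v ^ (m + i + 3))"
      by (simp add: lah_eq_0 del: funpow.simps)
    also have "\<dots> = lah (Suc m) 0 * ?D 0 * ?v ^ (m + 3) +
       (\<Sum>i\<le>m. of_nat (m + i + 3) * lah m (Suc i) * ?D (Suc i) * ?v ^ (m + i + 4))"
      unfolding sum.atMost_Suc_shift
      by (simp add: lah_Suc_0 eval_nat_numeral del: funpow.simps of_nat_Suc)
    also have "(\<Sum>i\<le>m. lah m i * ?D (Suc i) * ?v ^ (m + i + 4)) + \<dots>
       = (\<Sum>i\<le>Suc m. lah (Suc m) i * ?D i * ?v ^ (Suc m + i + 2))"
      unfolding sum.atMost_Suc_shift lah_Suc_Suc
      by (simp add: distrib_right sum.distrib eval_nat_numeral del: funpow.simps of_nat_Suc)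
    also have "(-1) ^ Suc m * - (\<Sum>i\<le>Suc m. lah (Suc m) i * ?D i * ?v ^ (Suc m + i + 2)) = g (Suc (Suc m)) w"
      unfolding g_def nat.case
      by (simp only: power_Suc[of _ "Suc m"] mult_minus_left mult_minus_right mult_1_left)
    finally show ?thesis
      unfolding Suc .
  qed
  from higher_deriv_eqI[where g = g, OF \<open>open S\<close> this \<open>z \<in> S\<close>, of "Suc m"]
  show ?thesis by (simp add: g_def del: funpow.simps)
qed

text \<open>The falling factorial r (r-1) ... (r-n+1) is (-1)^n times the Pochhammer symbol of -r.
  The excluded half-line is the branch cut of the principal power.\<close>

lemma higher_deriv_powr:
  fixes r :: complex
  assumes "z \<notin> \<real>\<^sub>\<le>\<^sub>0"
  shows "(deriv ^^ n) (\<lambda>w. w powr r) z = (-1) ^ n * pochhammer (- r) n * z powr (r - of_nat n)"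
proof -
  define g where "g = (\<lambda>n w. (-1) ^ n * pochhammer (- r) n * w powr (r - of_nat n))"
  have "(g n has_field_derivative g (Suc n) w) (at w)" if "w \<in> - \<real>\<^sub>\<le>\<^sub>0" for n w
    using that unfolding g_def
    by (auto intro!: derivative_eq_intros simp: pochhammer_Suc algebra_simps)
  from higher_deriv_eqI[where g = g and S = "- \<real>\<^sub>\<le>\<^sub>0", OF _ this, of z n] assms
  show ?thesis by (simp add: g_def open_Compl)
qed

section \<open>Differentiating an inversion relation at its fixed point\<close>

text \<open>At \<open>u = 1\<close> both \<open>G (inverse u)\<close> and
  \<open>u powr r * G u\<close> have derivatives expressed through those of \<open>G\<close> at the
  same point, and all powers of \<open>u\<close> become 1. The constant \<open>c\<close> is 1 for
  the polynomials and \<open>(-1) powi \<delta>\<close> for (c).\<close>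

lemma higher_deriv_inversion_relation:
  fixes G S :: "complex \<Rightarrow> complex" and r c :: complex
  assumes G: "G holomorphic_on {u. Re u > 0}" and S: "S holomorphic_on {u. Re u > 0}"
    and rel: "\<And>u. Re u > 0 \<Longrightarrow> G (inverse u) - c * (u powr r * G u) = S u"
    and "n \<ge> 1"
  shows "((-1) ^ n - c) * (deriv ^^ n) G 1 - c * (-1) ^ n * pochhammer (- r) n * G 1
    + (\<Sum>j = 1..n - 1. of_nat (n choose j) *
         ((-1) ^ n * (fact (n - 1) / fact (j - 1)) - c * (-1) ^ (n - j) * pochhammer (- r) (n - j))
         * (deriv ^^ j) G 1)
    = (deriv ^^ n) S 1"
proof -
  obtain m where n: "n = Suc m" using \<open>n \<ge> 1\<close> by (cases n) auto
  let ?A = "{u. Re u > 0}" and ?D = "\<lambda>j. (deriv ^^ j) G 1"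
  have A: "open ?A" "1 \<in> ?A" by (auto simp: open_halfspace_Re_gt)
  have inv: "inverse u \<in> ?A" if "u \<in> ?A" for u
    using that by (auto simp: complex_eq_iff intro!: divide_pos_pos add_pos_nonneg)
  have nz: "u \<noteq> 0" if "u \<in> ?A" for u using that by auto
  have Gi: "(\<lambda>u. G (inverse u)) holomorphic_on ?A"
  proof -
    have "inverse holomorphic_on ?A" "inverse ` ?A \<subseteq> ?A"
      using nz inv by (auto intro!: holomorphic_intros simp del: inverse_complex.sel)
    from holomorphic_on_compose_gen[OF this(1) G this(2)] show ?thesis
      by (simp add: o_def)
  qed
  have P: "(\<lambda>u. u powr r) holomorphic_on ?A"
    by (intro holomorphic_intros) (auto simp: complex_nonpos_Reals_iff)
  note PG = holomorphic_on_mult[OF P G]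
  have cPG: "(\<lambda>u. c * (u powr r * G u)) holomorphic_on ?A"
    by (intro holomorphic_intros PG)
  have *: "(deriv ^^ n) S 1 = (deriv ^^ n) (\<lambda>u. G (inverse u) - c * (u powr r * G u)) 1"
    by (rule higher_deriv_transform_within_open[OF S _ A])
      (auto intro!: holomorphic_intros Gi cPG PG simp: rel)
  have "(deriv ^^ n) S 1 = (deriv ^^ n) (\<lambda>u. G (inverse u)) 1 - c * (deriv ^^ n) (\<lambda>u. u powr r * G u) 1"
    unfolding * higher_deriv_diff[OF Gi cPG A] higher_deriv_cmult[OF PG A(2) A(1)] ..
  also have "(deriv ^^ n) (\<lambda>u. G (inverse u)) 1 = (-1) ^ n * (\<Sum>i\<le>m. lah m i * ?D (Suc i))"
    unfolding n using nz by (subst higher_deriv_compose_inverse[OF G A(1) A(1) _ inv A(2)]) (auto simp del: funpow.simps)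
  also have "(\<Sum>i\<le>m. lah m i * ?D (Suc i)) = (\<Sum>j = 1..n. lah m (j - 1) * ?D j)"
    unfolding n by (rule sum.reindex_bij_witness[of _ "\<lambda>j. j - 1" Suc]) (auto simp del: funpow.simps)
  also have "\<dots> = ?D n + (\<Sum>j = 1..n - 1. of_nat (n choose j) * (fact (n - 1) / fact (j - 1)) * ?D j)"
    unfolding n by (subst sum.nat_ivl_Suc') (auto intro!: sum.cong simp: lah_def simp del: funpow.simps)
  \<comment> \<open>The Leibniz sum is reversed so that \<open>j\<close> counts the derivatives
    falling on \<open>G\<close>; its two end terms are then split off.\<close>
  also have "(deriv ^^ n) (\<lambda>u. u powr r * G u) 1
      = (\<Sum>j = 0..n. of_nat (n choose j) * ((-1) ^ (n - j) * pochhammer (- r) (n - j)) * ?D j)"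
    unfolding higher_deriv_mult[OF P G A]
    by (rule sum.reindex_bij_witness[of _ "\<lambda>j. n - j" "\<lambda>j. n - j"])
      (auto simp: higher_deriv_powr binomial_symmetric[symmetric])
  also have "\<dots> = (-1) ^ n * pochhammer (- r) n * G 1 + ?D n +
      (\<Sum>j = 1..n - 1. of_nat (n choose j) * ((-1) ^ (n - j) * pochhammer (- r) (n - j)) * ?D j)"
    unfolding n
    by (subst sum.atLeast_Suc_atMost, simp, subst sum.nat_ivl_Suc', simp)
      (simp del: funpow.simps(2) binomial_Suc_Suc)
  finally show ?thesis
    by (simp add: algebra_simps sum_subtractf sum_distrib_left)
qed

section \<open>Bernoulli numbers and their starred variants\<close>

definition bernoulli_fps :: "real fps" where
  "bernoulli_fps = fps_X / (fps_exp 1 - 1)"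

text \<open>The divisor is not a unit, having no constant term; its subdegree 1 makes it divide
  \<open>fps_X\<close>, so the division is exact.\<close>

lemma bernoulli_fps_mult: "bernoulli_fps * (fps_exp 1 - 1) = fps_X"
proof -
  have "subdegree (fps_exp 1 - 1 :: real fps) = 1"
    by (rule subdegreeI) auto
  then show ?thesis
    unfolding bernoulli_fps_def by (intro dvd_div_mult_self) (auto simp: fps_dvd_iff)
qed

lemma nth_bernoulli_fps: "fps_nth bernoulli_fps n = bernoulli n / fact n"
  by (simp add: bernoulli_def bernoulli_fps_def)

lemma bernoulli_fps_eqI:
  assumes "a * (fps_exp 1 - 1) = b * (fps_exp 1 - 1 :: real fps)"
  shows "a = b"
  using assms by simp

text \<open>With b the generating function, b(-x) = b(x) + x, so an odd coefficient other than the
  first equals its own negative.\<close>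

lemma bernoulli_odd_eq_0:
  assumes "odd n" "n \<noteq> 1"
  shows "bernoulli n = 0"
proof -
  let ?E = "fps_exp 1 :: real fps" and ?E' = "fps_exp (-1) :: real fps"
  define b where "b = bernoulli_fps oo (fps_const (-1) * fps_X)"
  have "b * (?E' - 1) = fps_const (-1) * fps_X"
    using arg_cong[OF bernoulli_fps_mult, of "\<lambda>f. f oo (fps_const (-1) * fps_X)"]
    by (simp add: b_def fps_compose_mult_distrib fps_compose_sub_distrib del: fps_const_neg)
  moreover have E: "?E * ?E' = 1"
    by (simp flip: fps_exp_add_mult)
  \<comment> \<open>Since \<open>?E * ?E' = 1\<close>, the factor \<open>?E - 1\<close> is
    \<open>- (?E' - 1) * ?E\<close>, which turns the equation for \<open>?E'\<close> into one for
    \<open>?E\<close>.\<close>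
  moreover have "b * (?E - 1) = b * (?E * ?E') * ?E - b * (?E * ?E')"
    using E by (simp add: algebra_simps)
  moreover have "\<dots> = - (b * (?E' - 1)) * ?E * (?E * ?E')"
    using E by (simp add: algebra_simps)
  moreover have "fps_const (-1) = (-1 :: real fps)"
    by (simp flip: fps_const_neg)
  ultimately have "b * (?E - 1) = fps_X * ?E"
    by (simp only: mult_minus_left mult_1_left mult_1_right minus_minus)
  also have "\<dots> = (bernoulli_fps + fps_X) * (?E - 1)"
    by (simp add: distrib_right bernoulli_fps_mult) (simp add: algebra_simps)
  finally have "b = bernoulli_fps + fps_X" by (rule bernoulli_fps_eqI)
  from arg_cong[OF this, of "\<lambda>f. fps_nth f n"] assms show ?thesis
    unfolding b_def fps_nth_compose_linear by (simp add: nth_bernoulli_fps)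
qed

text \<open>This compares coefficients in e^x b(2x) = 2 b(x) - b(2x). That identity follows by
  cancelling e^x - 1 from b(2x) (e^x + 1) (e^x - 1) = 2x = 2 b(x) (e^x - 1).\<close>

lemma sum_binomial_power_2_bernoulli:
  "(\<Sum>k\<le>n. real (n choose k) * 2 ^ k * bernoulli k) = (2 - 2 ^ n) * bernoulli n"
proof -
  let ?E = "fps_exp 1 :: real fps"
  define b where "b = bernoulli_fps oo (fps_const 2 * fps_X)"
  have b: "fps_nth b k = 2 ^ k * fps_nth bernoulli_fps k" for k
    unfolding b_def by (rule fps_nth_compose_linear)
  have "b * (fps_exp 2 - 1) = fps_const 2 * fps_X"
    using arg_cong[OF bernoulli_fps_mult, of "\<lambda>f. f oo (fps_const 2 * fps_X)"]
    by (simp add: b_def fps_compose_mult_distrib fps_compose_sub_distrib)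
  moreover have "fps_exp 2 = ?E * ?E"
    by (simp flip: fps_exp_add_mult)
  ultimately have "(b * (?E + 1)) * (?E - 1) = (fps_const 2 * bernoulli_fps) * (?E - 1)"
    by (simp add: bernoulli_fps_mult mult.assoc) (simp add: algebra_simps)
  then have "b * (?E + 1) = fps_const 2 * bernoulli_fps" by (rule bernoulli_fps_eqI)
  then have "b * ?E = fps_const 2 * bernoulli_fps - b" by (simp add: algebra_simps)
  from arg_cong[OF this, of "\<lambda>f. fact n * fps_nth f n"]
  have *: "(2 - 2 ^ n) * bernoulli n = fact n * fps_nth (b * ?E) n"
    by (simp add: b nth_bernoulli_fps algebra_simps)
  show ?thesis
    unfolding * fps_mult_nth sum_distrib_left atLeast0AtMost
    by (intro sum.cong refl) (simp add: b nth_bernoulli_fps binomial_fact)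
qed

text \<open>The defining sum is the preceding binomial sum for s+1 without its last two terms,
  scaled by 2^(-s). At s = 1 the formula would give -1/4, not the prescribed 1/4.\<close>

lemma bernoulli_star_eq:
  assumes "s \<ge> 2"
  shows "bernoulli_star s = bernoulli s + (4 - 2 / 2 ^ s) * bernoulli (Suc s) / real (Suc s)"
proof -
  obtain t where s: "s = Suc t" using assms by (cases s) auto
  let ?S = "\<Sum>k\<le>t. real (Suc s choose k) * 2 ^ k * bernoulli k"
  have pow: "2 powi (int k - int s) = (2 ^ k / 2 ^ s :: real)" for k
    by (simp add: power_int_diff)
  have "(\<Sum>k = 0..s - 1. real ((s + 1) choose k) * 2 powi (int k - int s) * bernoulli k) = ?S / 2 ^ s"
    unfolding sum_divide_distrib pow by (simp add: s atLeast0AtMost)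
  then have *: "bernoulli_star s = - (1 / real (Suc s)) * (?S / 2 ^ s)"
    using assms by (simp add: bernoulli_star_def)
  have "?S + real (Suc s) * 2 ^ s * bernoulli s + 2 ^ Suc s * bernoulli (Suc s)
      = (2 - 2 ^ Suc s) * bernoulli (Suc s)"
    using sum_binomial_power_2_bernoulli[of "Suc s"] by (simp add: s)
  then have S: "?S = (2 - 2 ^ Suc s) * bernoulli (Suc s) - real (Suc s) * 2 ^ s * bernoulli s - 2 ^ Suc s * bernoulli (Suc s)"
    by linarith
  show ?thesis
    unfolding * S by (simp add: divide_simps del: of_nat_Suc) (simp add: algebra_simps)
qed

text \<open>The binomial sum is vacuous at n = 0, so \<open>bernoulli 0\<close> is read off the
  generating function; n = 1 and n = 2 then determine the next two values.\<close>

lemma bernoulli_2: "bernoulli 2 = 1 / 6"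
proof -
  have "bernoulli 0 = 1"
    using arg_cong[OF bernoulli_fps_mult, of "\<lambda>f. fps_nth f 1"]
    by (simp add: fps_mult_nth nth_bernoulli_fps)
  moreover from this have "bernoulli 1 = - 1 / 2"
    using sum_binomial_power_2_bernoulli[of 1] by simp
  ultimately show ?thesis using sum_binomial_power_2_bernoulli[of 2] by (simp add: eval_nat_numeral field_simps)
qed

text \<open>The correction term in \<open>bernoulli_star_eq\<close> contains an odd-index Bernoulli
  number, which vanishes.\<close>

lemma bernoulli_star_even:
  assumes "k \<ge> 1"
  shows "bernoulli_star (2 * k) = bernoulli (2 * k)"
  using assms bernoulli_odd_eq_0[of "Suc (2 * k)"] by (subst bernoulli_star_eq) auto

text \<open>For k >= 2 only the correction term of \<open>bernoulli_star_eq\<close> survives, and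
  its denominator 2k completes the factorial. At k = 1 the prescribed value 1/4 is exactly what the
  formula requires.\<close>

lemma bernoulli_star_odd:
  assumes "k \<ge> 1"
  shows "bernoulli_star (2 * k - 1) / fact (2 * k - 1) = 4 * (1 - 1 / 4 ^ k) * bernoulli (2 * k) / fact (2 * k)"
proof (cases "k = 1")
  case True
  then show ?thesis by (simp add: bernoulli_star_def bernoulli_2)
next
  case False
  then obtain m where k: "k = Suc (Suc m)"
    using assms by (metis One_nat_def not0_implies_Suc not_one_le_zero)
  have p: "(2::real) ^ (m * 2) = 4 ^ m" by (simp add: power_mult mult.commute[of m])
  have f: "fact (2 * k) = real (2 * k) * fact (2 * k - 1)"
    using assms by (subst fact_reduce) auto
  have "bernoulli_star (2 * k - 1) = (4 - 2 / 2 ^ (2 * k - 1)) * bernoulli (2 * k) / real (2 * k)"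
    using assms False bernoulli_odd_eq_0[of "2 * k - 1"]
    by (subst bernoulli_star_eq) (auto simp: k)
  also have "4 - 2 / 2 ^ (2 * k - 1) = 4 * (1 - 1 / 4 ^ k :: real)"
    by (simp add: k p field_simps)
  finally show ?thesis using f by simp
qed

section \<open>Palindromic real polynomials\<close>

lemma poly_map_poly_of_real:
  "poly (map_poly complex_of_real p) (of_real x) = of_real (poly p x)"
  by (induction p) (simp_all add: map_poly_pCons)

lemma higher_pderiv_map_poly_of_real:
  "(pderiv ^^ n) (map_poly complex_of_real p) = map_poly of_real ((pderiv ^^ n) p)"
proof (induction n)
  case (Suc n)
  have "pderiv (map_poly complex_of_real q) = map_poly of_real (pderiv q)" for q
    by (rule poly_eqI) (simp add: coeff_map_poly coeff_pderiv)
  with Suc show ?case by simp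
qed simp

lemma higher_deriv_poly:
  fixes p :: "'a::real_normed_field poly"
  shows "(deriv ^^ n) (poly p) z = poly ((pderiv ^^ n) p) z"
  using higher_deriv_eqI[where g = "\<lambda>n. poly ((pderiv ^^ n) p)" and S = UNIV and z = z and n = n]
  by (simp add: poly_DERIV)

text \<open>Palindromicity says p(1/u) = u^(-w) p(u): the inversion relation with c = 1, r = -w and
  S = 0, applied to the complexification \<open>q\<close>. Here \<open>w\<close> is only a formal
  degree, since the extreme coefficients may vanish, as they do for \<open>T\<close>.\<close>

lemma palindromic_poly_deriv_relation:
  fixes p :: "real poly"
  assumes deg: "degree p \<le> w" and sym: "\<And>k. k \<le> w \<Longrightarrow> coeff p (w - k) = coeff p k"
    and "n \<ge> 1"
  shows "(1 - (-1) ^ n) * poly ((pderiv ^^ n) p) 1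
    + (\<Sum>j = 1..n - 1. real (n choose j) *
         (fact (n - 1) / fact (j - 1) - (-1) ^ j * pochhammer (real w) (n - j))
         * poly ((pderiv ^^ j) p) 1)
    = pochhammer (real w) n * poly p 1"
proof -
  define q where "q = map_poly complex_of_real p"
  have q: "poly q u = (\<Sum>k\<le>w. of_real (coeff p k) * u ^ k)" for u
  proof -
    have "degree q \<le> w"
      using deg by (auto intro!: degree_le simp: q_def coeff_map_poly coeff_eq_0)
    from poly_as_sum_of_monoms'[OF this] have "poly q u = poly (\<Sum>k\<le>w. monom (coeff q k) k) u"
      by simp
    then show ?thesis by (simp add: poly_sum poly_monom q_def coeff_map_poly)
  qed
  have recip: "poly q (inverse u) - 1 * (u powr (- of_nat w) * poly q u) = 0" if "Re u > 0" for u
  proof -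
    have "u \<noteq> 0" using that by auto
    have "poly q u = (\<Sum>k\<le>w. of_real (coeff p (w - k)) * u ^ (w - k))"
      unfolding q by (rule sum.reindex_bij_witness[of _ "\<lambda>k. w - k" "\<lambda>k. w - k"]) auto
    also have "\<dots> = u ^ w * poly q (inverse u)"
      unfolding q sum_distrib_left using \<open>u \<noteq> 0\<close>
      by (intro sum.cong) (auto simp: sym power_diff field_simps)
    finally show ?thesis using \<open>u \<noteq> 0\<close> by (simp add: powr_minus powr_nat')
  qed
  have d: "(deriv ^^ j) (poly q) 1 = of_real (poly ((pderiv ^^ j) p) 1)" for j
    unfolding higher_deriv_poly q_def higher_pderiv_map_poly_of_real
    using poly_map_poly_of_real[of _ 1] by simp
  define E where "E = ((-1) ^ n - 1) * poly ((pderiv ^^ n) p) 1 - (-1) ^ n * pochhammer (real w) n * poly p 1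
    + (\<Sum>j = 1..n - 1. real (n choose j) *
         ((-1) ^ n * (fact (n - 1) / fact (j - 1)) - (-1) ^ (n - j) * pochhammer (real w) (n - j))
         * poly ((pderiv ^^ j) p) 1)"
  have "poly q holomorphic_on {u. Re u > 0}"
    by (meson holomorphic_onI field_differentiable_def has_field_derivative_at_within poly_DERIV)
  then have "complex_of_real E = 0"
    using higher_deriv_inversion_relation[OF _ _ recip \<open>n \<ge> 1\<close>] d[of 0]
    by (simp add: d E_def flip: pochhammer_of_real)
  \<comment> \<open>\<open>E\<close> has the signs of the general inversion relation. Multiplying by
    (-1)^n gives the required ones, because (-1)^n (-1)^(n-j) = (-1)^j.\<close>
  then have "(-1) ^ n * E = 0" by simp
  moreover have "(-1) ^ n * E = (1 - (-1) ^ n) * poly ((pderiv ^^ n) p) 1 - pochhammer (real w) n * poly p 1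
    + (\<Sum>j = 1..n - 1. real (n choose j) *
         (fact (n - 1) / fact (j - 1) - (-1) ^ j * pochhammer (real w) (n - j))
         * poly ((pderiv ^^ j) p) 1)"
  proof -
    have s: "(-1) ^ n * (-1) ^ n = (1 :: real)"
      by (simp flip: power_add)
    have sj: "(-1) ^ n * (-1) ^ (n - j) = ((-1) ^ j :: real)" if "j \<le> n" for j
      using that by (simp add: minus_one_power_iff)
    have expand: "a * (x * (a * y - b * z) * t) = x * ((a * a) * y - (a * b) * z) * t" for a b x y z t :: real
      by (simp add: algebra_simps)
    have lead: "a * ((a - 1) * x - a * y * z) = (a * a - a) * x - (a * a) * y * z" for a x y z :: real
      by (simp add: algebra_simps)
    show ?thesis
      unfolding E_def distrib_left[of "(-1) ^ n"] sum_distrib_left lead expand s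
      by (intro arg_cong2[of _ _ _ _ "(+)"] sum.cong) (auto simp: sj)
  qed
  ultimately show ?thesis by linarith
qed

lemma coeff_sum_monom_even:
  "coeff (\<Sum>k\<le>m. monom (c k) (2 * k)) j = (if even j \<and> j \<le> 2 * m then c (j div 2) else 0)"
proof (cases "even j")
  case True
  then obtain i where "j = 2 * i" by auto
  then show ?thesis by (simp add: coeff_sum)
next
  case False
  then have "2 * k \<noteq> j" for k by auto
  with False show ?thesis by (simp add: coeff_sum)
qed

lemma even_palindromic_poly_deriv_relation:
  fixes c :: "nat \<Rightarrow> real" and m :: nat
  defines "p \<equiv> \<Sum>k\<le>m. monom (c k) (2 * k)"
  assumes sym: "\<And>k. k \<le> m \<Longrightarrow> c (m - k) = c k" and "n \<ge> 1"
  shows "(1 - (-1) ^ n) * poly ((pderiv ^^ n) p) 1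
    + (\<Sum>j = 1..n - 1. real (n choose j) *
         (fact (n - 1) / fact (j - 1) - (-1) ^ j * pochhammer (real (2 * m)) (n - j))
         * poly ((pderiv ^^ j) p) 1)
    = pochhammer (real (2 * m)) n * poly p 1"
proof (rule palindromic_poly_deriv_relation)
  show "degree p \<le> 2 * m"
    by (rule degree_le) (simp add: p_def coeff_sum_monom_even)
  show "coeff p (2 * m - k) = coeff p k" if "k \<le> 2 * m" for k
  proof (cases "even k")
    case True
    then obtain i where "k = 2 * i" by auto
    then show ?thesis using that sym[of i]
      by (simp add: p_def coeff_sum_monom_even flip: diff_mult_distrib2)
  next
    case False
    then show ?thesis using that by (simp add: p_def coeff_sum_monom_even)
  qed
qed fact

section \<open>The coefficients of \<open>T\<close>\<close>

text \<open>Replacing z by z/2 scales the coefficient of z^(2k) by 4^(-k), so the difference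
  supplies the factor 1 - 4^(-k) that turns the even-index part into \<open>e k\<close>. The
  odd-index part is already \<open>4 * e (Suc s - k)\<close>, and the product is symmetric under k
  -> s+1-k.\<close>

lemma gen_ramanujan_poly_diff_eq:
  fixes s :: nat
  defines "e \<equiv> \<lambda>k. (1 - 1 / 4 ^ k) * bernoulli (2 * k) / fact (2 * k)"
  shows "gen_ramanujan_poly (2 * s) - pcompose (gen_ramanujan_poly (2 * s)) [:0, 1/2:]
    = (\<Sum>k\<le>Suc s. monom (4 * e k * e (Suc s - k)) (2 * k))"
proof (rule poly_eqI)
  fix j
  let ?c = "\<lambda>k. bernoulli_star (2 * s + 1 - 2 * k) * bernoulli_star (2 * k)
                  / (fact (2 * s + 1 - 2 * k) * fact (2 * k))"
  have "gen_ramanujan_poly (2 * s) = (\<Sum>k\<le>s. monom (?c k) (2 * k))"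
    by (simp add: gen_ramanujan_poly_def atLeast0AtMost)
  then have L: "coeff (gen_ramanujan_poly (2 * s) - pcompose (gen_ramanujan_poly (2 * s)) [:0, 1/2:]) j
     = (1 - (1/2) ^ j) * (if even j \<and> j \<le> 2 * s then ?c (j div 2) else 0)"
    by (simp only: coeff_diff coeff_pcompose_linear coeff_sum_monom_even) (simp add: algebra_simps)
  have *: "(1 - (1/2) ^ (2 * k)) * ?c k = 4 * e k * e (Suc s - k)" if "k \<le> s" for k
  \<comment> \<open>\<open>bernoulli_star_even\<close> does not cover k = 0; there both sides vanish
    because 1 - 4^0 = 0.\<close>
  proof (cases "k = 0")
    case True
    then show ?thesis by (simp add: e_def)
  next
    case False
    have "bernoulli_star (2 * s + 1 - 2 * k) / fact (2 * s + 1 - 2 * k) = 4 * e (Suc s - k)"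
      using bernoulli_star_odd[of "Suc s - k"] that
      by (simp add: e_def Suc_diff_le diff_mult_distrib2)
    moreover have "(1 - (1/2) ^ (2 * k)) * (bernoulli_star (2 * k) / fact (2 * k)) = e k"
      using False by (simp add: e_def bernoulli_star_even power_mult power_divide)
    moreover have "a * (x * y / (u * v)) = (x / u) * (a * (y / v))" for a x y u v :: real
      by simp
    ultimately show ?thesis by (simp only: ac_simps)
  qed
  show "coeff (gen_ramanujan_poly (2 * s) - pcompose (gen_ramanujan_poly (2 * s)) [:0, 1/2:]) j
     = coeff (\<Sum>k\<le>Suc s. monom (4 * e k * e (Suc s - k)) (2 * k)) j"
  proof (cases "even j")
    case True
    then obtain k where j: "j = 2 * k" by auto
    consider "k \<le> s" | "k = Suc s" | "k > Suc s" by linarith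
    then show ?thesis
    proof cases
      case 1
      then show ?thesis using *[of k] unfolding L coeff_sum_monom_even by (simp add: j)
    next
      \<comment> \<open>The left side has no term of degree 2s+2; on the right the factor
        \<open>e 0 = 0\<close> removes it.\<close>
      case 2
      then show ?thesis unfolding L coeff_sum_monom_even by (simp add: j e_def)
    next
      case 3
      then show ?thesis unfolding L coeff_sum_monom_even by (simp add: j)
    qed
  next
    case False
    then show ?thesis unfolding L coeff_sum_monom_even by simp
  qed
qed

section \<open>Transfer to the upper half plane\<close>

text \<open>The rotation z = iu carries the right half plane to the upper one, the fixed point 1 to
  i, and u -> 1/u to z -> -1/z. Each derivative of \<open>G\<close> costs a factor i, and dividing
  by i^n at the end produces the powers i^(j-n).\<close>

lemma higher_deriv_relation_at_ii:
  fixes F S :: "complex \<Rightarrow> complex" and r c :: complex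
  assumes F: "F holomorphic_on {z. Im z > 0}" and S: "S holomorphic_on {z. Re z > 0}"
    and rel: "\<And>z. Im z > 0 \<Longrightarrow> F (- 1 / z) - c * (z / \<i>) powr r * F z = S (z / \<i>)"
    and "n \<ge> 1"
  shows "((-1) ^ n - c) * (deriv ^^ n) F \<i> - c * pochhammer (- r) n * \<i> ^ n * F \<i>
    + (\<Sum>j = 1..n - 1. of_nat (n choose j) *
         ((-1) ^ n * (fact (n - 1) / fact (j - 1)) - c * (-1) ^ (n - j) * pochhammer (- r) (n - j))
         * \<i> powi (int j - int n) * (deriv ^^ j) F \<i>)
    = (deriv ^^ n) S 1 / \<i> ^ n"
proof -
  define G where "G = (\<lambda>u. F (\<i> * u))"
  have opn: "open {u. Re u > 0}" "open {z. Im z > 0}"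
    by (auto simp: open_halfspace_Re_gt open_halfspace_Im_gt)
  have "G holomorphic_on {u. Re u > 0}"
    unfolding G_def using holomorphic_on_compose_gen[OF _ F, of "\<lambda>u. \<i> * u" "{u. Re u > 0}"]
    by (auto simp: o_def image_subset_iff intro!: holomorphic_intros)
  moreover have "G (inverse u) - c * (u powr r * G u) = S u" if "Re u > 0" for u
  proof -
    have "u \<noteq> 0" using that by auto
    then have "- 1 / (\<i> * u) = \<i> * inverse u"
      by (simp add: field_simps)
    then show ?thesis using rel[of "\<i> * u"] that by (simp add: G_def mult.assoc)
  qed
  moreover have D: "(deriv ^^ j) G 1 = \<i> ^ j * (deriv ^^ j) F \<i>" for j
    unfolding G_def using higher_deriv_compose_linear[OF F opn, of 1 \<i>] by simp
  ultimately have *: "(deriv ^^ n) S 1 =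
    ((-1) ^ n - c) * (\<i> ^ n * (deriv ^^ n) F \<i>) - c * (-1) ^ n * pochhammer (- r) n * G 1
    + (\<Sum>j = 1..n - 1. of_nat (n choose j) *
         ((-1) ^ n * (fact (n - 1) / fact (j - 1)) - c * (-1) ^ (n - j) * pochhammer (- r) (n - j))
         * (\<i> ^ j * (deriv ^^ j) F \<i>))"
    using higher_deriv_inversion_relation[OF _ S _ \<open>n \<ge> 1\<close>, of G c r] unfolding D by simp
  \<comment> \<open>This turns the sign (-1)^n of the \<open>G 1\<close> term, after division by
    i^n, into the factor i^n of the \<open>F \<i>\<close> term.\<close>
  have "(-1) ^ n = \<i> ^ n * \<i> ^ n"
    by (simp flip: power_mult_distrib)
  then have m: "(-1) ^ n / \<i> ^ n = \<i> ^ n" by simp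
  have p: "\<i> ^ j / \<i> ^ n = \<i> powi (int j - int n)" for j
    by (simp add: power_int_diff)
  have "c * (-1) ^ n * pochhammer (- r) n * G 1 / \<i> ^ n
      = c * pochhammer (- r) n * ((-1) ^ n / \<i> ^ n) * F \<i>"
    by (simp add: G_def)
  then show ?thesis
    unfolding * add_divide_distrib diff_divide_distrib sum_divide_distrib m
    by (intro arg_cong2[of _ _ _ _ "(+)"] arg_cong2[of _ _ _ _ "(-)"] sum.cong)
      (simp_all flip: p)
qed

theorem theorem7:
  shows
  "(\<forall>(s::nat) (n::nat). n \<ge> 1 \<longrightarrow>
      (let R = ramanujan_poly s in
        (1 - (-1)^n) * poly ((pderiv ^^ n) R) 1
        + (\<Sum>j = 1..n - 1. real (n choose j) *
             (fact (n - 1) / fact (j - 1) - (-1)^j * pochhammer (real (2 * s + 2)) (n - j))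
             * poly ((pderiv ^^ j) R) 1)
        = pochhammer (real (2 * s + 2)) n * poly R 1))
   \<and>
   (\<forall>(s::nat) (n::nat). s \<ge> 1 \<longrightarrow> n \<ge> 1 \<longrightarrow>
      (let R = gen_ramanujan_poly (2 * s);
           T = R - pcompose R [:0, 1/2:] in
        (1 - (-1)^n) * poly ((pderiv ^^ n) T) 1
        + (\<Sum>j = 1..n - 1. real (n choose j) *
             (fact (n - 1) / fact (j - 1) - (-1)^j * pochhammer (real (2 * s + 2)) (n - j))
             * poly ((pderiv ^^ j) T) 1)
        = pochhammer (real (2 * s + 2)) n * poly T 1))
   \<and>
   (\<forall>(r::real) (\<delta>::int) (F::complex \<Rightarrow> complex) (S::complex \<Rightarrow> complex).
      F analytic_on {z. Im z > 0} \<longrightarrow> S analytic_on {z. Re z > 0} \<longrightarrow>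
      (\<forall>z. Im z > 0 \<longrightarrow>
         F (- 1 / z) - (-1) powi \<delta> * (z / \<i>) powr (complex_of_real r) * F z = S (z / \<i>)) \<longrightarrow>
      (\<forall>n::nat. n \<ge> 1 \<longrightarrow>
         ((-1)^n - (-1) powi \<delta>) * (deriv ^^ n) F \<i>
         - (-1) powi \<delta> * pochhammer (- complex_of_real r) n * \<i>^n * F \<i>
         + (\<Sum>j = 1..n - 1. of_nat (n choose j) *
              ((-1)^n * (fact (n - 1) / fact (j - 1))
               - (-1) powi \<delta> * (-1)^(n - j) * pochhammer (- complex_of_real r) (n - j))
              * \<i> powi (int j - int n) * (deriv ^^ j) F \<i>)
         = (deriv ^^ n) S 1 / \<i>^n))"
proof (intro conjI allI impI, goal_cases)
  case (1 s n)
  define c where "c = (\<lambda>k. bernoulli (2 * k) * bernoulli (2 * s + 2 - 2 * k)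
                              / (fact (2 * k) * fact (2 * s + 2 - 2 * k)))"
  have R: "ramanujan_poly s = (\<Sum>k\<le>Suc s. monom (c k) (2 * k))"
    by (simp add: ramanujan_poly_def c_def atLeast0AtMost)
  have "c (Suc s - k) = c k" if "k \<le> Suc s" for k
    using that by (simp add: c_def diff_mult_distrib2 mult.commute)
  from even_palindromic_poly_deriv_relation[of "Suc s" c, OF this 1]
  show ?case unfolding R Let_def by simp
next
  case (2 s n)
  show ?case
    unfolding Let_def gen_ramanujan_poly_diff_eq
    using even_palindromic_poly_deriv_relation[OF _ 2(2), of "Suc s"
        "\<lambda>k. 4 * ((1 - 1 / 4 ^ k) * bernoulli (2 * k) / fact (2 * k))
           * ((1 - 1 / 4 ^ (Suc s - k)) * bernoulli (2 * (Suc s - k)) / fact (2 * (Suc s - k)))"]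
    by (simp add: mult.commute)
next
  case (3 r \<delta> F S n)
  then show ?case
    by (intro higher_deriv_relation_at_ii analytic_imp_holomorphic) auto
qed

end
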